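(* Let $G$ be a finite simple graph with $\gamma(G)=1$ that contains the path $P_4$ on four vertices as an induced subgraph. Then no $1$-witness of $G$ is free, i.e., every $1$-witness of $G$ is neither left-free nor right-free.
   Context: All graphs are finite, simple and undirected. A graph $G=(V,E)$ is a star-$k$-PCG if there exist a weight function $w:V\to\mathbb{R}^+$ and $k$ pairwise disjoint intervals $I_1,\dots,I_k$ such that for distinct $u,v\in V$, $uv\in E$ if and only if $w(u)+w(v)\in\bigcup_i I_i$; the weighted graph $G^w$ with these intervals is a $k$-witness. Intervals are $I_i=[a_i,b_i]$ with $b_i<a_{i+1}$. The star number $\gamma(G)$ is the least positive $k$ such that $G$ is a star-$k$-PCG. For distinct $u,v$, $w(uv)=w(u)+w(v)$. For $\gamma(G)=k$, a $k$-witness is left-free if every non-edge $e$ satisfies $w(e)>b_1$, right-free if every non-edge $e$ satisfies $w(e)<a_k$, and free if it is left-free or right-free. *)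

theory Defs
  imports Complex_Main "Graph_Theory.Graph_Theory"
begin

text \<open>Finite simple undirected graphs are modelled by the locale \<^verbatim>\<open>graph\<close> of
  Graph_Theory: finite, loop-free, symmetric digraphs without parallel arcs. The undirected edge
  \<open>uv\<close> is the pair of arcs between \<open>u\<close> and \<open>v\<close>, so \<open>uv \<in> E\<close> reads \<open>u \<rightarrow>\<^bsub>G\<^esub> v\<close>.\<close>

definition path_graph :: "nat \<Rightarrow> nat pair_pre_digraph" where
  "path_graph n =
    \<lparr>pverts = {..<n}, parcs = {(i, j). i < n \<and> j < n \<and> (j = Suc i \<or> i = Suc j)}\<rparr>"

definition contains_induced :: "('a, 'b) pre_digraph \<Rightarrow> ('c, 'd) pre_digraph \<Rightarrow> bool" where
  "contains_induced G P \<longleftrightarrow> (\<exists>H. induced_subgraph H G \<and> digraph_iso H P)"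

text \<open>The intervals are \<open>I\<^sub>i = [a i, b i]\<close> for \<open>1 \<le> i \<le> k\<close>; values of \<open>a\<close>, \<open>b\<close> at other indices
  and of \<open>w\<close> outside the vertex set are irrelevant. Disjointness follows from
  \<open>a i \<le> b i < a (i + 1)\<close>.\<close>

definition star_witness ::
  "('a, 'b) pre_digraph \<Rightarrow> nat \<Rightarrow> ('a \<Rightarrow> real) \<Rightarrow> (nat \<Rightarrow> real) \<Rightarrow> (nat \<Rightarrow> real) \<Rightarrow> bool" where
  "star_witness G k w a b \<longleftrightarrow>
    (\<forall>v\<in>verts G. 0 < w v) \<and>
    (\<forall>i\<in>{1..k}. a i \<le> b i) \<and>
    (\<forall>i\<in>{1..<k}. b i < a (Suc i)) \<and>
    (\<forall>u\<in>verts G. \<forall>v\<in>verts G. u \<noteq> v \<longrightarrow>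
      (u \<rightarrow>\<^bsub>G\<^esub> v \<longleftrightarrow> w u + w v \<in> (\<Union>i\<in>{1..k}. {a i..b i})))"

definition star_PCG :: "nat \<Rightarrow> ('a, 'b) pre_digraph \<Rightarrow> bool" where
  "star_PCG k G \<longleftrightarrow> (\<exists>w a b. star_witness G k w a b)"

definition star_number :: "('a, 'b) pre_digraph \<Rightarrow> nat" where
  "star_number G = (LEAST k. 0 < k \<and> star_PCG k G)"

text \<open>The following are only meaningful for a \<open>k\<close>-witness \<open>w, a, b\<close> of a graph \<open>G\<close> with
  \<open>star_number G = k\<close>.\<close>

definition left_free ::
  "('a, 'b) pre_digraph \<Rightarrow> ('a \<Rightarrow> real) \<Rightarrow> (nat \<Rightarrow> real) \<Rightarrow> bool" where
  "left_free G w b \<longleftrightarrow>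
    (\<forall>u\<in>verts G. \<forall>v\<in>verts G. u \<noteq> v \<and> \<not> u \<rightarrow>\<^bsub>G\<^esub> v \<longrightarrow> b 1 < w u + w v)"

definition right_free ::
  "('a, 'b) pre_digraph \<Rightarrow> nat \<Rightarrow> ('a \<Rightarrow> real) \<Rightarrow> (nat \<Rightarrow> real) \<Rightarrow> bool" where
  "right_free G k w a \<longleftrightarrow>
    (\<forall>u\<in>verts G. \<forall>v\<in>verts G. u \<noteq> v \<and> \<not> u \<rightarrow>\<^bsub>G\<^esub> v \<longrightarrow> w u + w v < a k)"

definition free_witness ::
  "('a, 'b) pre_digraph \<Rightarrow> nat \<Rightarrow> ('a \<Rightarrow> real) \<Rightarrow> (nat \<Rightarrow> real) \<Rightarrow> (nat \<Rightarrow> real) \<Rightarrow> bool" where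
  "free_witness G k w a b \<longleftrightarrow> left_free G w b \<or> right_free G k w a"

end

theory Submission
  imports Defs
begin

text \<open>In an induced path \<open>p q r s\<close> the edges \<open>pq\<close>, \<open>rs\<close> have the same total weight as the non-edges
  \<open>pr\<close>, \<open>qs\<close>. A free 1-witness puts every edge weight on one side of every non-edge weight, which
  makes one of these two totals strictly larger than the other.\<close>

text \<open>Compatibility gives both graphs the same \<open>tail\<close> and \<open>head\<close>
  maps, and \<open>H\<close> keeps every arc of \<open>G\<close> between its own vertices.\<close>

lemma induced_subgraph_dominates_iff:
  assumes "induced_subgraph H G" "u \<in> verts H" "v \<in> verts H"
  shows "u \<rightarrow>\<^bsub>H\<^esub> v \<longleftrightarrow> u \<rightarrow>\<^bsub>G\<^esub> v"
proof -
  have "compatible G H" and arcs: "arcs H = {e \<in> arcs G. tail G e \<in> verts H \<and> head G e \<in> verts H}"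
    using assms(1) by (auto simp: induced_subgraph_def subgraph_def)
  then show ?thesis
    using assms(2,3) by (auto simp: arcs_ends_conv compatible_def image_iff)
qed

text \<open>Trades the intermediate subgraph \<open>H\<close> and its isomorphism for an embedding
  of the vertices of \<open>P\<close> directly into \<open>G\<close>.\<close>

lemma contains_inducedE:
  assumes "contains_induced G P"
  obtains f where "inj_on f (verts P)" "f ` verts P \<subseteq> verts G"
    "\<And>x y. x \<in> verts P \<Longrightarrow> y \<in> verts P \<Longrightarrow> f x \<rightarrow>\<^bsub>G\<^esub> f y \<longleftrightarrow> x \<rightarrow>\<^bsub>P\<^esub> y"
proof -
  obtain H hom where H: "induced_subgraph H G"
    and hom: "pre_digraph.digraph_isomorphism H hom" and P: "P = app_iso hom H"
    using assms by (auto simp: contains_induced_def digraph_iso_def)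
  interpret H: wf_digraph H
    using hom by (simp add: pre_digraph.digraph_isomorphism_def)
  \<comment> \<open>\<open>hom\<close> runs from \<open>H\<close> to \<open>P\<close>, so the
    embedding comes from its inverse.\<close>
  let ?f = "iso_verts (H.inv_iso hom)"
  have inv: "?f x \<in> verts H" "iso_verts hom (?f x) = x" if "x \<in> verts P" for x
    using that hom by (auto simp: P)
  show thesis
  proof (rule that)
    show "inj_on ?f (verts P)"
      using inv(2) by (rule inj_on_inverseI)
    show "?f ` verts P \<subseteq> verts G"
      using inv(1) H by (auto simp: induced_subgraph_def subgraph_def)
    fix x y assume xy: "x \<in> verts P" "y \<in> verts P"
    have "?f x \<rightarrow>\<^bsub>H\<^esub> ?f y \<longleftrightarrow> x \<rightarrow>\<^bsub>P\<^esub> y"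
    proof
      assume "?f x \<rightarrow>\<^bsub>H\<^esub> ?f y"
      then have "(iso_verts hom (?f x), iso_verts hom (?f y)) \<in> arcs_ends P"
        by (force simp: P H.arcs_ends_app_iso_eq[OF hom])
      then show "x \<rightarrow>\<^bsub>P\<^esub> y"
        using inv(2) xy by simp
    next
      assume "x \<rightarrow>\<^bsub>P\<^esub> y"
      then obtain u v where "u \<rightarrow>\<^bsub>H\<^esub> v" "x = iso_verts hom u" "y = iso_verts hom v"
        by (auto simp: P H.arcs_ends_app_iso_eq[OF hom])
      \<comment> \<open>As ends of an arc, \<open>u\<close> and \<open>v\<close> are vertices of
        \<open>H\<close>, where the inverse undoes \<open>hom\<close>; hence \<open>?f x = u\<close>
        and \<open>?f y = v\<close>.\<close>
      then show "?f x \<rightarrow>\<^bsub>H\<^esub> ?f y"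
        using hom H.adj_in_verts by auto
    qed
    then show "?f x \<rightarrow>\<^bsub>G\<^esub> ?f y \<longleftrightarrow> x \<rightarrow>\<^bsub>P\<^esub> y"
      using induced_subgraph_dominates_iff[OF H] inv(1) xy by blast
  qed
qed

text \<open>The four adjacency facts concern exactly the pairs in (p + q) + (r + s) = (p + r) + (q +
  s), read as weights.\<close>

lemma contains_induced_P4E:
  assumes "contains_induced G (with_proj (path_graph 4))"
  obtains p q r s where "{p, q, r, s} \<subseteq> verts G" "distinct [p, q, r, s]"
    "p \<rightarrow>\<^bsub>G\<^esub> q" "r \<rightarrow>\<^bsub>G\<^esub> s" "\<not> p \<rightarrow>\<^bsub>G\<^esub> r" "\<not> q \<rightarrow>\<^bsub>G\<^esub> s"
proof -
  have verts: "verts (with_proj (path_graph 4)) = {0, 1, 2, 3}"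
    by (auto simp: path_graph_def)
  obtain f where "inj_on f {0, 1, 2, 3::nat}" "f ` {0, 1, 2, 3} \<subseteq> verts G"
    and dom: "\<And>i j. i \<in> {0, 1, 2, 3} \<Longrightarrow> j \<in> {0, 1, 2, 3} \<Longrightarrow>
      f i \<rightarrow>\<^bsub>G\<^esub> f j \<longleftrightarrow> i \<rightarrow>\<^bsub>with_proj (path_graph 4)\<^esub> j"
    using contains_inducedE[OF assms] unfolding verts by blast
  then show thesis
    by (intro that[of "f 0" "f 1" "f 2" "f 3"])
      (auto simp: inj_on_def path_graph_def)
qed

theorem theorem1:
  fixes G :: "('a, 'b) pre_digraph"
  assumes "graph G"
    and "star_number G = 1"
    and "contains_induced G (with_proj (path_graph 4))"
  shows "\<forall>w a b. star_witness G 1 w a b \<longrightarrow> \<not> free_witness G 1 w a b"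
proof (intro allI impI notI)
  fix w a b
  assume wit: "star_witness G 1 w a b" and free: "free_witness G 1 w a b"
  obtain p q r s where P4: "{p, q, r, s} \<subseteq> verts G" "distinct [p, q, r, s]"
    "p \<rightarrow>\<^bsub>G\<^esub> q" "r \<rightarrow>\<^bsub>G\<^esub> s" "\<not> p \<rightarrow>\<^bsub>G\<^esub> r" "\<not> q \<rightarrow>\<^bsub>G\<^esub> s"
    using contains_induced_P4E[OF assms(3)] by blast
  have "w p + w q \<in> {a 1..b 1}" "w r + w s \<in> {a 1..b 1}"
    using wit P4 by (auto simp: star_witness_def)
  \<comment> \<open>With k = 1, \<open>a 1\<close> and \<open>b 1\<close> bound the same interval.
    Freeness forces both non-edges onto the same side of it; a general witness could put one on each
    side.\<close>
  moreover have "(b 1 < w p + w r \<and> b 1 < w q + w s) \<or> (w p + w r < a 1 \<and> w q + w s < a 1)"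
    using free P4 by (auto simp: free_witness_def left_free_def right_free_def)
  ultimately show False
    by auto
qed

end
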